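(* Let $\lambda\in\mathbb{BC}$ with $|\lambda|_k=1$, let $W\in\mathbb U_{\mathbb{BC}}$, and let $\Psi:\mathbb U_{\mathbb{BC}}\to\mathbb U_{\mathbb{BC}}$ be the automorphism $$\Psi(Z)=\lambda\,\frac{Z+W}{1+W^{\dagger_3}Z}.$$ Then for every $f$ in the bicomplex Hardy space $H^2(\mathbb U_{\mathbb{BC}})$, $$\left(\frac{1-|\Psi(0)|_k}{1+|\Psi(0)|_k}\right)^{1/2}\|f\|_{\mathbb D,H^2(\mathbb U_{\mathbb{BC}})}\ \leq'\ \|C_\Psi(f)\|_{\mathbb D,H^2(\mathbb U_{\mathbb{BC}})}\ \leq'\ \left(\frac{1+|\Psi(0)|_k}{1-|\Psi(0)|_k}\right)^{1/2}\|f\|_{\mathbb D,H^2(\mathbb U_{\mathbb{BC}})},$$ where $C_\Psi f=f\circ\Psi$.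
   Context: Bicomplex numbers: $\mathbb{BC}=\{z+jw : z,w\in\mathbb C(i)\}$, a commutative ring with $i^2=j^2=-1$, $ij=ji$; $\mathbb C(i)$ is the complex field with imaginary unit $i$. Put $e_1=\frac{1+ij}{2}$, $e_2=\frac{1-ij}{2}$; these are idempotents with $e_1e_2=0$, $e_1+e_2=1$, and every $Z=z+jw$ is uniquely $Z=e_1z_1+e_2z_2$ with $z_1=z-iw$, $z_2=z+iw\in\mathbb C(i)$. The conjugation $\dagger_3$ is $Z^{\dagger_3}=\bar z-j\bar w=e_1\overline{z_1}+e_2\overline{z_2}$. Hyperbolic numbers: $\mathbb D=\{e_1\alpha_1+e_2\alpha_2:\alpha_1,\alpha_2\in\mathbb R\}$, $\mathbb D^+=\{e_1\alpha_1+e_2\alpha_2:\alpha_1,\alpha_2\ge 0\}$, and $\alpha\leq'\beta$ means $\beta-\alpha\in\mathbb D^+$. The hyperbolic modulus is $|Z|_k=e_1|z_1|+e_2|z_2|\in\mathbb D^+$. Square roots and quotients of hyperbolic numbers are taken componentwise with respect to $e_1,e_2$. $\mathbb U$ is the open unit disc of $\mathbb C(i)$ and $\mathbb U_{\mathbb{BC}}=\{e_1z_1+e_2z_2: z_1,z_2\in\mathbb U\}$. A function $f:\mathbb U_{\mathbb{BC}}\to\mathbb{BC}$ is bicomplex holomorphic if it has a bicomplex derivative at each point; equivalently $f(e_1z_1+e_2z_2)=e_1f_1(z_1)+e_2f_2(z_2)$ with $f_1,f_2$ holomorphic on $\mathbb U$. The bicomplex Hardy space $H^2(\mathbb U_{\mathbb{BC}})$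 is the set of bicomplex holomorphic $f(Z)=\sum_{n\ge0}a_nZ^n$ ($a_n\in\mathbb{BC}$) on $\mathbb U_{\mathbb{BC}}$ with $\sum_n|a_n|_k^2$ convergent, with $\mathbb D$-valued norm $\|f\|_{\mathbb D,H^2(\mathbb U_{\mathbb{BC}})}=\left(\sum_n|a_n|_k^2\right)^{1/2}$; equivalently $f_1,f_2\in H^2(\mathbb U)$ and $\|f\|_{\mathbb D,H^2(\mathbb U_{\mathbb{BC}})}=e_1\|f_1\|_{H^2(\mathbb U)}+e_2\|f_2\|_{H^2(\mathbb U)}$. *)

theory Defs
  imports "HOL-Analysis.Analysis"
begin

section \<open>Bicomplex numbers\<close>

text \<open>\<open>Bicomplex z w\<close> is $z + jw$ with $z, w$ in the complex field with unit $i$.\<close>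

datatype bicomplex = Bicomplex (bc_re: complex) (bc_im: complex)

lemma bicomplex_eq_iff: "Z = W \<longleftrightarrow> bc_re Z = bc_re W \<and> bc_im Z = bc_im W"
  by (cases Z; cases W) auto

instantiation bicomplex :: comm_ring_1
begin

definition zero_bicomplex :: bicomplex where "0 = Bicomplex 0 0"
definition one_bicomplex :: bicomplex where "1 = Bicomplex 1 0"
definition plus_bicomplex :: "bicomplex \<Rightarrow> bicomplex \<Rightarrow> bicomplex" where
  "Z + W = Bicomplex (bc_re Z + bc_re W) (bc_im Z + bc_im W)"
definition uminus_bicomplex :: "bicomplex \<Rightarrow> bicomplex" where
  "- Z = Bicomplex (- bc_re Z) (- bc_im Z)"
definition minus_bicomplex :: "bicomplex \<Rightarrow> bicomplex \<Rightarrow> bicomplex" where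
  "Z - W = Bicomplex (bc_re Z - bc_re W) (bc_im Z - bc_im W)"
definition times_bicomplex :: "bicomplex \<Rightarrow> bicomplex \<Rightarrow> bicomplex" where
  "Z * W = Bicomplex (bc_re Z * bc_re W - bc_im Z * bc_im W)
                     (bc_re Z * bc_im W + bc_im Z * bc_re W)"

instance
  by standard
    (auto simp: zero_bicomplex_def one_bicomplex_def plus_bicomplex_def uminus_bicomplex_def
      minus_bicomplex_def times_bicomplex_def bicomplex_eq_iff algebra_simps)

end

lemma bicomplex_sel [simp]:
  "bc_re 0 = 0" "bc_im 0 = 0" "bc_re 1 = 1" "bc_im 1 = 0"
  "bc_re (Z + W) = bc_re Z + bc_re W" "bc_im (Z + W) = bc_im Z + bc_im W"
  "bc_re (- Z) = - bc_re Z" "bc_im (- Z) = - bc_im Z"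
  "bc_re (Z - W) = bc_re Z - bc_re W" "bc_im (Z - W) = bc_im Z - bc_im W"
  "bc_re (Z * W) = bc_re Z * bc_re W - bc_im Z * bc_im W"
  "bc_im (Z * W) = bc_re Z * bc_im W + bc_im Z * bc_re W"
  by (simp_all add: zero_bicomplex_def one_bicomplex_def plus_bicomplex_def
      uminus_bicomplex_def minus_bicomplex_def times_bicomplex_def)

instantiation bicomplex :: real_vector
begin

definition scaleR_bicomplex :: "real \<Rightarrow> bicomplex \<Rightarrow> bicomplex" where
  "r *\<^sub>R Z = Bicomplex (r *\<^sub>R bc_re Z) (r *\<^sub>R bc_im Z)"

instance
  by standard (simp_all add: scaleR_bicomplex_def bicomplex_eq_iff algebra_simps)

end

text \<open>The Euclidean norm is used only to fix the topology in which limits and series are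
  taken; it is not submultiplicative.\<close>

instantiation bicomplex :: real_normed_vector
begin

definition norm_bicomplex :: "bicomplex \<Rightarrow> real" where
  "norm Z = sqrt ((norm (bc_re Z))\<^sup>2 + (norm (bc_im Z))\<^sup>2)"
definition dist_bicomplex_def: "dist Z W = norm (Z - W :: bicomplex)"
definition sgn_bicomplex_def: "sgn (Z :: bicomplex) = inverse (norm Z) *\<^sub>R Z"
definition uniformity_bicomplex_def:
  "(uniformity :: (bicomplex \<times> bicomplex) filter) =
     (INF e\<in>{0<..}. principal {(Z, W). dist Z W < e})"
definition open_bicomplex_def:
  "open (S :: bicomplex set) \<longleftrightarrow> (\<forall>Z\<in>S. \<forall>\<^sub>F (Z', W) in uniformity. Z' = Z \<longrightarrow> W \<in> S)"

instance
proof
  have norm_pair: "norm Z = norm (bc_re Z, bc_im Z)" for Z :: bicomplex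
    by (simp add: norm_bicomplex_def norm_prod_def)
  fix r :: real and Z W :: bicomplex and S :: "bicomplex set"
  show "dist Z W = norm (Z - W)" by (rule dist_bicomplex_def)
  show "sgn Z = Z /\<^sub>R norm Z" by (rule sgn_bicomplex_def)
  show "uniformity = (INF e\<in>{0<..}. principal {(Z :: bicomplex, W). dist Z W < e})"
    by (rule uniformity_bicomplex_def)
  show "open S \<longleftrightarrow> (\<forall>Z\<in>S. \<forall>\<^sub>F (Z', W) in uniformity. Z' = Z \<longrightarrow> W \<in> S)"
    by (rule open_bicomplex_def)
  show "norm Z = 0 \<longleftrightarrow> Z = 0"
    by (simp add: norm_bicomplex_def bicomplex_eq_iff add_nonneg_eq_0_iff)
  show "norm (Z + W) \<le> norm Z + norm W"
    using norm_triangle_ineq[of "(bc_re Z, bc_im Z)" "(bc_re W, bc_im W)"]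
    by (simp add: norm_pair)
  show "norm (r *\<^sub>R Z) = \<bar>r\<bar> * norm Z"
    using norm_scaleR[of r "(bc_re Z, bc_im Z)"]
    by (simp add: norm_pair scaleR_bicomplex_def)
qed

end

subsection \<open>Idempotent decomposition\<close>

definition bc_of_complex :: "complex \<Rightarrow> bicomplex" where
  "bc_of_complex z = Bicomplex z 0"

definition e1 :: bicomplex where "e1 = Bicomplex (1 / 2) (\<i> / 2)"
definition e2 :: bicomplex where "e2 = Bicomplex (1 / 2) (- \<i> / 2)"

definition bc_idem :: "complex \<Rightarrow> complex \<Rightarrow> bicomplex" where
  "bc_idem z1 z2 = e1 * bc_of_complex z1 + e2 * bc_of_complex z2"

definition bc_comp1 :: "bicomplex \<Rightarrow> complex" where
  "bc_comp1 Z = bc_re Z - \<i> * bc_im Z"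
definition bc_comp2 :: "bicomplex \<Rightarrow> complex" where
  "bc_comp2 Z = bc_re Z + \<i> * bc_im Z"

lemma bc_comp_idem [simp]: "bc_comp1 (bc_idem z1 z2) = z1" "bc_comp2 (bc_idem z1 z2) = z2"
  by (simp_all add: bc_idem_def bc_comp1_def bc_comp2_def e1_def e2_def bc_of_complex_def
      field_simps)

lemma bc_idem_comp [simp]: "bc_idem (bc_comp1 Z) (bc_comp2 Z) = Z"
  by (simp add: bc_idem_def bc_comp1_def bc_comp2_def e1_def e2_def bc_of_complex_def
      bicomplex_eq_iff field_simps)

lemma bc_comp_mult [simp]:
  "bc_comp1 (Z * W) = bc_comp1 Z * bc_comp1 W" "bc_comp2 (Z * W) = bc_comp2 Z * bc_comp2 W"
  by (simp_all add: bc_comp1_def bc_comp2_def algebra_simps)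

lemma bc_comp_one [simp]: "bc_comp1 1 = 1" "bc_comp2 1 = 1"
  by (simp_all add: bc_comp1_def bc_comp2_def)

text \<open>Division is componentwise. With the convention \<open>inverse 0 = 0\<close> on \<^typ>\<open>complex\<close>, it
  agrees with the inverse of the ring exactly at the units, i.e. where both idempotent
  components are nonzero.\<close>

instantiation bicomplex :: inverse
begin

definition inverse_bicomplex :: "bicomplex \<Rightarrow> bicomplex" where
  "inverse Z = bc_idem (inverse (bc_comp1 Z)) (inverse (bc_comp2 Z))"
definition divide_bicomplex :: "bicomplex \<Rightarrow> bicomplex \<Rightarrow> bicomplex" where
  "divide Z W = bc_idem (bc_comp1 Z / bc_comp1 W) (bc_comp2 Z / bc_comp2 W)"

instance ..

end

lemma bicomplex_dvd_one_iff:
  fixes Z :: bicomplex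
  shows "Z dvd 1 \<longleftrightarrow> bc_comp1 Z \<noteq> 0 \<and> bc_comp2 Z \<noteq> 0"
proof
  assume "Z dvd 1"
  then obtain W where "1 = Z * W" by (rule dvdE)
  then have "bc_comp1 Z * bc_comp1 W = 1" "bc_comp2 Z * bc_comp2 W = 1"
    by (metis bc_comp_mult(1) bc_comp_one(1), metis bc_comp_mult(2) bc_comp_one(2))
  then show "bc_comp1 Z \<noteq> 0 \<and> bc_comp2 Z \<noteq> 0" by auto
next
  assume nz: "bc_comp1 Z \<noteq> 0 \<and> bc_comp2 Z \<noteq> 0"
  have "Z * inverse Z
      = bc_idem (bc_comp1 (Z * inverse Z)) (bc_comp2 (Z * inverse Z))"
    by (simp only: bc_idem_comp)
  also have "\<dots> = bc_idem (bc_comp1 1) (bc_comp2 1)"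
    using nz by (simp only: bc_comp_mult) (simp add: inverse_bicomplex_def)
  also have "\<dots> = 1" by (rule bc_idem_comp)
  finally have "1 = Z * inverse Z" ..
  then show "Z dvd 1" by (rule dvdI)
qed

lemma bicomplex_divide_mult_cancel:
  fixes Z W :: bicomplex
  assumes "W dvd 1"
  shows "Z / W * W = Z"
proof -
  have "bc_comp1 (Z / W * W) = bc_comp1 Z" "bc_comp2 (Z / W * W) = bc_comp2 Z"
    using assms by (simp_all add: bicomplex_dvd_one_iff divide_bicomplex_def)
  then show ?thesis by (metis bc_idem_comp)
qed

subsection \<open>Conjugation, hyperbolic order and modulus\<close>

definition bc_cnj3 :: "bicomplex \<Rightarrow> bicomplex" where
  "bc_cnj3 Z = Bicomplex (cnj (bc_re Z)) (- cnj (bc_im Z))"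

definition hyp_nonneg :: "bicomplex set" where
  "hyp_nonneg = {bc_idem (of_real a) (of_real b) | a b :: real. 0 \<le> a \<and> 0 \<le> b}"

definition hyp_le :: "bicomplex \<Rightarrow> bicomplex \<Rightarrow> bool" (infix "\<preceq>" 50) where
  "\<alpha> \<preceq> \<beta> \<longleftrightarrow> \<beta> - \<alpha> \<in> hyp_nonneg"

definition bc_mod :: "bicomplex \<Rightarrow> bicomplex" where
  "bc_mod Z = bc_idem (of_real (norm (bc_comp1 Z))) (of_real (norm (bc_comp2 Z)))"

text \<open>Meant for hyperbolic arguments, whose idempotent components are real, so that
  \<^const>\<open>Re\<close> loses nothing.\<close>

definition hyp_sqrt :: "bicomplex \<Rightarrow> bicomplex" where
  "hyp_sqrt \<alpha> = bc_idem (of_real (sqrt (Re (bc_comp1 \<alpha>)))) (of_real (sqrt (Re (bc_comp2 \<alpha>))))"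

section \<open>The bicomplex Hardy space\<close>

definition bc_disc :: "bicomplex set" where
  "bc_disc = {bc_idem z1 z2 | z1 z2. norm z1 < 1 \<and> norm z2 < 1}"

text \<open>As usual for bicomplex derivatives, the increment \<open>H\<close> avoids the zero divisors; in
  this ring the non-units are exactly \<open>0\<close> and the zero divisors.\<close>

definition bc_differentiable :: "(bicomplex \<Rightarrow> bicomplex) \<Rightarrow> bicomplex \<Rightarrow> bool" where
  "bc_differentiable f Z \<longleftrightarrow>
     (\<exists>D. ((\<lambda>H. (f (Z + H) - f Z) / H) \<longlongrightarrow> D) (at 0 within {H. H dvd 1}))"

definition bc_holomorphic_on :: "(bicomplex \<Rightarrow> bicomplex) \<Rightarrow> bicomplex set \<Rightarrow> bool" where
  "bc_holomorphic_on f S \<longleftrightarrow> (\<forall>Z\<in>S. bc_differentiable f Z)"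

text \<open>A function on the bicomplex disc is modelled by a total function; only its values on
  \<^const>\<open>bc_disc\<close> matter below.\<close>

definition bc_power_series_on_disc :: "(bicomplex \<Rightarrow> bicomplex) \<Rightarrow> (nat \<Rightarrow> bicomplex) \<Rightarrow> bool" where
  "bc_power_series_on_disc f a \<longleftrightarrow> (\<forall>Z\<in>bc_disc. (\<lambda>n. a n * Z ^ n) sums f Z)"

definition bc_hardy2 :: "(bicomplex \<Rightarrow> bicomplex) set" where
  "bc_hardy2 = {f. bc_holomorphic_on f bc_disc \<and>
     (\<exists>a. bc_power_series_on_disc f a \<and> summable (\<lambda>n. (bc_mod (a n))\<^sup>2))}"

text \<open>The coefficient sequence of a power series on the disc is unique, so \<open>THE\<close> is
  meaningful whenever such a sequence exists.\<close>

definition bc_coeffs :: "(bicomplex \<Rightarrow> bicomplex) \<Rightarrow> nat \<Rightarrow> bicomplex" where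
  "bc_coeffs f = (THE a. bc_power_series_on_disc f a)"

definition bc_hardy2_norm :: "(bicomplex \<Rightarrow> bicomplex) \<Rightarrow> bicomplex" where
  "bc_hardy2_norm f = hyp_sqrt (\<Sum>n. (bc_mod (bc_coeffs f n))\<^sup>2)"

definition bc_comp_op ::
    "(bicomplex \<Rightarrow> bicomplex) \<Rightarrow> (bicomplex \<Rightarrow> bicomplex) \<Rightarrow> bicomplex \<Rightarrow> bicomplex" where
  "bc_comp_op \<Psi> f = f \<circ> \<Psi>"

end

theory Submission
  imports Defs "HOL-Complex_Analysis.Complex_Analysis"
begin

text \<open>
  Everything splits along the idempotents, so it suffices to bound \<open>f \<circ> \<phi>\<close> in the classical Hardy
  space of the disc for a disc automorphism \<open>\<phi>\<close>. On the unit circle \<open>\<phi>\<close> is unimodular, so by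
  Cauchy's formula the powers of \<open>\<phi>\<close> have the Toeplitz Gram matrix with entries \<open>b ^ (m - n)\<close> for
  \<open>m \<ge> n\<close> and conjugate-symmetric below the diagonal, where \<open>b = \<phi> 0\<close>. Its absolute row sums are
  at most \<open>1 + 2 * \<Sum>k\<ge>1. \<bar>b\<bar> ^ k = (1 + \<bar>b\<bar>) / (1 - \<bar>b\<bar>)\<close>, so the Schur test gives the upper bound
  for polynomials, and a limit of the partial sums of \<open>f\<close> gives it in general. The lower bound is
  the upper bound for the inverse automorphism, which has the same \<open>\<bar>b\<bar>\<close>.
\<close>

section \<open>Composition with inner functions in the classical Hardy space\<close>

definition taylor_coeff :: "(complex \<Rightarrow> complex) \<Rightarrow> nat \<Rightarrow> complex" where
  "taylor_coeff f k = (deriv ^^ k) f 0 / fact k"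

lemma norm_circlepath01 [simp]: "norm (circlepath 0 1 t) = 1"
  by (simp add: circlepath)

lemma unit_mult_cnj:
  assumes "norm z = 1"
  shows "z * cnj z = 1"
  using assms by (simp flip: complex_norm_square)

text \<open>Cauchy's formula for the \<open>k\<close>-th derivative, with
  \<open>dz = 2 * pi * \<i> * z dt\<close>: on the circle \<open>1 / z = cnj z\<close>, so the
  integrand becomes the \<open>k\<close>-th Fourier integrand.\<close>

lemma has_integral_taylor_coeff:
  assumes cont: "continuous_on (cball 0 1) g" and hol: "g holomorphic_on ball 0 1"
  shows "((\<lambda>t. g (circlepath 0 1 t) * cnj (circlepath 0 1 t) ^ k) has_integral taylor_coeff g k) {0..1}"
proof -
  let ?z = "circlepath 0 1"
  have "((\<lambda>u. g u / (u - 0) ^ Suc k) has_contour_integral (2 * pi * \<i>) / fact k * (deriv ^^ k) g 0) ?z"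
    using assms by (intro Cauchy_has_contour_integral_higher_derivative_circlepath) auto
  then have "((\<lambda>t. g (?z t) / ?z t ^ Suc k * (2 * pi * \<i> * ?z t)) has_integral
      (2 * pi * \<i>) / fact k * (deriv ^^ k) g 0) {0..1}"
    unfolding has_contour_integral_def
    by (rule has_integral_eq[rotated]) (simp add: vector_derivative_circlepath01, simp add: circlepath)
  then have "((\<lambda>t. 1 / (2 * pi * \<i>) * (g (?z t) / ?z t ^ Suc k * (2 * pi * \<i> * ?z t))) has_integral
      1 / (2 * pi * \<i>) * ((2 * pi * \<i>) / fact k * (deriv ^^ k) g 0)) {0..1}"
    by (rule has_integral_mult_right)
  moreover have "1 / (2 * pi * \<i>) * (g (?z t) / ?z t ^ Suc k * (2 * pi * \<i> * ?z t)) = g (?z t) * cnj (?z t) ^ k" for t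
  proof -
    have nz: "?z t \<noteq> 0"
      by (metis norm_circlepath01 norm_zero zero_neq_one)
    have "cnj (?z t) = inverse (?z t)"
      using unit_mult_cnj[of "?z t"] nz by (simp add: field_simps)
    then show ?thesis
      using nz by (simp add: power_inverse) (simp add: field_simps)
  qed
  ultimately show ?thesis
    by (simp add: taylor_coeff_def)
qed

section \<open>Gram matrix of the powers of an inner function\<close>

text \<open>On the unit circle this is \<open>b ^ m * cnj b ^ n\<close> after cancelling
  \<open>b * cnj b = 1\<close>. The reduced form is what survives averaging, where \<open>b\<close>
  moves inside the disc; the case split keeps the natural subtraction exact.\<close>

definition toeplitz_kernel :: "complex \<Rightarrow> nat \<Rightarrow> nat \<Rightarrow> complex" where
  "toeplitz_kernel b m n = (if n \<le> m then b ^ (m - n) else cnj b ^ (n - m))"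

lemma unit_power_mult_cnj:
  assumes "norm z = 1"
  shows "z ^ m * cnj z ^ n = toeplitz_kernel z m n"
proof (cases "n \<le> m")
  case True
  then have "z ^ m * cnj z ^ n = z ^ (m - n) * (z * cnj z) ^ n"
    by (simp add: power_mult_distrib flip: power_add mult.assoc)
  then show ?thesis
    using True unit_mult_cnj[OF assms] by (simp add: toeplitz_kernel_def)
next
  case False
  then have "z ^ m * cnj z ^ n = cnj z ^ (n - m) * (z * cnj z) ^ m"
    by (simp add: power_mult_distrib mult.left_commute flip: power_add)
  then show ?thesis
    using False unit_mult_cnj[OF assms] by (simp add: toeplitz_kernel_def)
qed

lemma norm_square_sum:
  fixes a :: "nat \<Rightarrow> complex"
  assumes "norm z = 1"
  shows "(norm (\<Sum>n<N. a n * z ^ n))\<^sup>2 = Re (\<Sum>m<N. \<Sum>n<N. a m * cnj (a n) * toeplitz_kernel z m n)"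
proof -
  have "complex_of_real ((norm (\<Sum>n<N. a n * z ^ n))\<^sup>2)
      = (\<Sum>m<N. a m * z ^ m) * cnj (\<Sum>n<N. a n * z ^ n)"
    by (rule complex_norm_square)
  also have "\<dots> = (\<Sum>m<N. \<Sum>n<N. a m * cnj (a n) * (z ^ m * cnj z ^ n))"
    by (simp add: sum_product mult_ac)
  finally show ?thesis
    by (metis (no_types, lifting) Re_complex_of_real unit_power_mult_cnj[OF assms] sum.cong)
qed

text \<open>Continuity on the closed disc allows integration over the unit circle itself instead of
  radial limits.\<close>

locale inner_function =
  fixes \<phi> :: "complex \<Rightarrow> complex"
  assumes cont: "continuous_on (cball 0 1) \<phi>" and hol: "\<phi> holomorphic_on ball 0 1"
    and unimodular: "norm z = 1 \<Longrightarrow> norm (\<phi> z) = 1"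
begin

text \<open>Each kernel entry is a power of \<open>\<phi>\<close> or the conjugate of one, so the
  mean value property replaces \<open>\<phi>\<close> on the circle by
  \<open>\<phi> 0\<close>.\<close>

lemma has_integral_kernel:
  "((\<lambda>t. toeplitz_kernel (\<phi> (circlepath 0 1 t)) m n) has_integral toeplitz_kernel (\<phi> 0) m n) {0..1}"
proof -
  have pow: "((\<lambda>t. \<phi> (circlepath 0 1 t) ^ k) has_integral \<phi> 0 ^ k) {0..1}" for k
    using has_integral_taylor_coeff[of "\<lambda>z. \<phi> z ^ k" 0] cont hol
    by (simp add: taylor_coeff_def continuous_on_power holomorphic_on_power)
  have "((\<lambda>t. cnj (\<phi> (circlepath 0 1 t) ^ k)) has_integral cnj (\<phi> 0 ^ k)) {0..1}" for k
    using has_integral_linear[OF pow bounded_linear_cnj] by (simp add: o_def)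
  with pow show ?thesis
    by (simp add: toeplitz_kernel_def)
qed

lemma has_integral_norm_square_sum:
  "((\<lambda>t. (norm (\<Sum>n<N. a n * \<phi> (circlepath 0 1 t) ^ n))\<^sup>2) has_integral
     Re (\<Sum>m<N. \<Sum>n<N. a m * cnj (a n) * toeplitz_kernel (\<phi> 0) m n)) {0..1}"
proof -
  have "((\<lambda>t. \<Sum>m<N. \<Sum>n<N. a m * cnj (a n) * toeplitz_kernel (\<phi> (circlepath 0 1 t)) m n) has_integral
     (\<Sum>m<N. \<Sum>n<N. a m * cnj (a n) * toeplitz_kernel (\<phi> 0) m n)) {0..1}"
    by (intro has_integral_sum has_integral_mult_right has_integral_kernel finite_lessThan)
  then show ?thesis
    unfolding norm_square_sum[OF unimodular[OF norm_circlepath01]] by (rule has_integral_Re)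
qed

end

text \<open>Turns \<open>has_integral_norm_square_sum\<close> into Parseval's identity for
  polynomials, since the kernel at 0 is the identity matrix.\<close>

lemma inner_function_id: "inner_function (\<lambda>z. z)"
  by unfold_locales auto

text \<open>With \<open>s\<close> the Taylor partial sum, the mean of
  \<open>norm (g - s) ^ 2\<close> is nonnegative. The mean of \<open>norm s ^ 2\<close> and the real
  part of the cross term both equal \<open>S\<close>, leaving \<open>0 \<le> M - S\<close>.\<close>

lemma bessel_inequality:
  assumes cont: "continuous_on (cball 0 1) g" and hol: "g holomorphic_on ball 0 1"
    and int: "((\<lambda>t. (norm (g (circlepath 0 1 t)))\<^sup>2) has_integral M) {0..1}"
  shows "(\<Sum>k<K. (norm (taylor_coeff g k))\<^sup>2) \<le> M"
proof -
  define c where "c = taylor_coeff g"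
  define s where "s z = (\<Sum>k<K. c k * z ^ k)" for z
  define S where "S = (\<Sum>k<K. (norm (c k))\<^sup>2)"
  let ?z = "circlepath 0 1"
  \<comment> \<open>The diagonal entries are 1 because \<open>0 ^ 0 = 1\<close>.\<close>
  have kernel0: "toeplitz_kernel 0 m n = (if m = n then 1 else 0)" for m n
    by (simp add: toeplitz_kernel_def)
  have "(\<Sum>n<K. c m * cnj (c n) * toeplitz_kernel 0 m n) = complex_of_real ((norm (c m))\<^sup>2)" if "m < K" for m
  proof -
    have "(\<Sum>n<K. c m * cnj (c n) * toeplitz_kernel 0 m n) = (\<Sum>n<K. if m = n then c m * cnj (c n) else 0)"
      by (intro sum.cong) (auto simp: kernel0)
    also have "\<dots> = c m * cnj (c m)"
      using that by simp
    finally show ?thesis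
      by (simp only: complex_norm_square)
  qed
  then have "Re (\<Sum>m<K. \<Sum>n<K. c m * cnj (c n) * toeplitz_kernel 0 m n) = S"
    by (simp add: S_def)
  then have int_s: "((\<lambda>t. (norm (s (?z t)))\<^sup>2) has_integral S) {0..1}"
    using inner_function.has_integral_norm_square_sum[OF inner_function_id, where N = K and a = c]
    by (simp add: s_def)
  have "((\<lambda>t. \<Sum>k<K. cnj (c k) * (g (?z t) * cnj (?z t) ^ k)) has_integral (\<Sum>k<K. cnj (c k) * c k)) {0..1}"
    unfolding c_def
    by (intro has_integral_sum has_integral_mult_right has_integral_taylor_coeff cont hol finite_lessThan)
  then have "((\<lambda>t. g (?z t) * cnj (s (?z t))) has_integral (\<Sum>k<K. cnj (c k) * c k)) {0..1}"
    by (simp add: s_def sum_distrib_left mult_ac)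
  then have int_gs: "((\<lambda>t. Re (g (?z t) * cnj (s (?z t)))) has_integral Re (\<Sum>k<K. cnj (c k) * c k)) {0..1}"
    by (rule has_integral_Re)
  have "cnj (c k) * c k = complex_of_real ((norm (c k))\<^sup>2)" for k
    by (simp only: complex_norm_square mult.commute)
  then have "Re (\<Sum>k<K. cnj (c k) * c k) = S"
    by (simp only: S_def Re_sum Re_complex_of_real)
  then have "((\<lambda>t. (norm (g (?z t)))\<^sup>2 - 2 * Re (g (?z t) * cnj (s (?z t))) + (norm (s (?z t)))\<^sup>2)
      has_integral M - 2 * S + S) {0..1}"
    using int_gs by (intro has_integral_add has_integral_diff has_integral_mult_right int int_s) simp
  moreover have "0 \<le> (norm x)\<^sup>2 - 2 * Re (x * cnj y) + (norm y)\<^sup>2" for x y :: complex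
  proof -
    have "(norm x)\<^sup>2 - 2 * Re (x * cnj y) + (norm y)\<^sup>2 = (norm (x - y))\<^sup>2"
      by (simp only: cmod_power2) (simp add: power2_eq_square algebra_simps)
    then show ?thesis by simp
  qed
  ultimately have "0 \<le> M - 2 * S + S"
    by (rule has_integral_nonneg)
  then show ?thesis
    by (simp add: S_def c_def)
qed

section \<open>The Schur test\<close>

lemma sum_geometric_dist_le:
  fixes r :: real
  assumes "0 \<le> r" "r < 1"
  shows "(\<Sum>n<N. r ^ (if n \<le> m then m - n else n - m)) \<le> (1 + r) / (1 - r)"
proof -
  have geo: "(\<Sum>k<n. r ^ k) \<le> 1 / (1 - r)" for n
    using assms sum_le_suminf[of "\<lambda>k. r ^ k" "{..<n}"]
    by (simp add: summable_geometric suminf_geometric)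
  \<comment> \<open>Lengthening the range to \<open>m + N\<close> ensures that it reaches the
    diagonal even if \<open>N \<le> m\<close>, so the row always splits there into two geometric
    sums.\<close>
  have "(\<Sum>n<N. r ^ (if n \<le> m then m - n else n - m)) 
      \<le> (\<Sum>n<m + N. r ^ (if n \<le> m then m - n else n - m))"
    using assms by (intro sum_mono2) auto
  also have "\<dots> = (\<Sum>n<m. r ^ (m - n)) + (\<Sum>n<N. r ^ n)"
    by (induction N) (auto intro!: sum.cong)
  also have "(\<Sum>n<m. r ^ (m - n)) = r * (\<Sum>n<m. r ^ n)"
    by (subst sum.nat_diff_reindex[symmetric]) (simp add: sum_distrib_left flip: power_Suc)
  also have "r * (\<Sum>n<m. r ^ n) + (\<Sum>n<N. r ^ n) \<le> r * (1 / (1 - r)) + 1 / (1 - r)"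
    using assms by (intro add_mono mult_left_mono geo)
  also have "\<dots> = (1 + r) / (1 - r)"
    by (simp add: add_divide_distrib)
  finally show ?thesis .
qed

text \<open>By the arithmetic-geometric mean inequality the form is at most half a row-sum plus half
  a column-sum expression. These agree by symmetry, and \<open>sum_geometric_dist_le\<close> bounds
  every row.\<close>

lemma schur_test_toeplitz_kernel:
  fixes a :: "nat \<Rightarrow> complex"
  assumes "norm b < 1"
  shows "Re (\<Sum>m<N. \<Sum>n<N. a m * cnj (a n) * toeplitz_kernel b m n)
    \<le> (1 + norm b) / (1 - norm b) * (\<Sum>n<N. (norm (a n))\<^sup>2)"
proof -
  define d :: "nat \<Rightarrow> nat \<Rightarrow> nat" where "d m n = (if n \<le> m then m - n else n - m)" for m n
  define r where "r = norm b"
  define A where "A n = (norm (a n))\<^sup>2" for n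
  have norm_kernel: "norm (toeplitz_kernel b m n) = r ^ d m n" for m n
    by (simp add: toeplitz_kernel_def d_def r_def norm_power)
  have "Re (a m * cnj (a n) * toeplitz_kernel b m n) \<le> (A m * r ^ d m n + A n * r ^ d n m) / 2" for m n
  proof -
    have "Re (a m * cnj (a n) * toeplitz_kernel b m n) \<le> norm (a m * cnj (a n) * toeplitz_kernel b m n)"
      by (rule complex_Re_le_cmod)
    also have "\<dots> = (norm (a m) * norm (a n)) * r ^ d m n"
      by (simp add: norm_mult norm_kernel)
    also have "\<dots> \<le> ((A m + A n) / 2) * r ^ d m n"
      using sum_squares_bound[of "norm (a m)" "norm (a n)"]
      by (intro mult_right_mono) (auto simp: A_def r_def)
    also have "d m n = d n m"
      by (simp add: d_def)
    then have "((A m + A n) / 2) * r ^ d m n = (A m * r ^ d m n + A n * r ^ d n m) / 2"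
      by (simp add: algebra_simps)
    finally show ?thesis .
  qed
  then have "Re (\<Sum>m<N. \<Sum>n<N. a m * cnj (a n) * toeplitz_kernel b m n)
      \<le> (\<Sum>m<N. \<Sum>n<N. (A m * r ^ d m n + A n * r ^ d n m) / 2)"
    by (simp add: sum_mono)
  also have "\<dots> = ((\<Sum>m<N. \<Sum>n<N. A m * r ^ d m n) + (\<Sum>m<N. \<Sum>n<N. A n * r ^ d n m)) / 2"
    by (simp add: sum.distrib flip: sum_divide_distrib)
  also have "(\<Sum>m<N. \<Sum>n<N. A n * r ^ d n m) = (\<Sum>m<N. \<Sum>n<N. A m * r ^ d m n)"
    by (rule sum.swap)
  also have "((\<Sum>m<N. \<Sum>n<N. A m * r ^ d m n) + (\<Sum>m<N. \<Sum>n<N. A m * r ^ d m n)) / 2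
      = (\<Sum>m<N. A m * (\<Sum>n<N. r ^ d m n))"
    by (simp add: field_simps flip: sum_distrib_left)
  also have "\<dots> \<le> (\<Sum>m<N. A m * ((1 + r) / (1 - r)))"
    unfolding d_def using assms
    by (intro sum_mono mult_left_mono sum_geometric_dist_le) (auto simp: r_def A_def)
  finally show ?thesis
    by (simp add: r_def A_def sum_distrib_left mult.commute)
qed

section \<open>Power series on the unit disc\<close>

lemma holomorphic_taylor_sums:
  assumes "f holomorphic_on ball 0 1" "norm z < 1"
  shows "(\<lambda>n. taylor_coeff f n * z ^ n) sums f z"
  using holomorphic_power_series[OF assms(1), of z] assms(2) by (simp add: taylor_coeff_def)

lemma one_le_conv_radius:
  fixes a :: "nat \<Rightarrow> complex"
  assumes "\<And>z. norm z < 1 \<Longrightarrow> summable (\<lambda>n. a n * z ^ n)"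
  shows "1 \<le> conv_radius a"
proof (rule conv_radius_geI_ex')
  fix r :: real assume "0 < r" "ereal r < 1"
  then show "summable (\<lambda>n. a n * of_real r ^ n)"
    by (intro assms) simp
qed

text \<open>The series is evaluated as a formal power series, which is holomorphic within its radius
  of convergence and has its own coefficients as Taylor coefficients.\<close>

lemma taylor_coeff_unique:
  assumes "\<And>z. norm z < 1 \<Longrightarrow> (\<lambda>n. a n * z ^ n) sums f z"
  shows "f holomorphic_on ball 0 1" "taylor_coeff f = a"
proof -
  have rad: "1 \<le> conv_radius a"
    using assms by (intro one_le_conv_radius) (auto simp: sums_iff)
  then have F: "fps_conv_radius (Abs_fps a) \<ge> 1"
    by (simp add: fps_conv_radius_def)
  have ev: "eval_fps (Abs_fps a) z = f z" if "norm z < 1" for z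
    using assms[OF that] by (simp add: eval_fps_def sums_iff)
  have "eval_fps (Abs_fps a) holomorphic_on ball 0 1"
    using F by (intro holomorphic_intros) (auto simp: in_eball_iff intro!: less_le_trans[OF _ F])
  then show "f holomorphic_on ball 0 1"
    by (rule holomorphic_transform) (auto simp: ev)
  have "f has_fps_expansion Abs_fps a"
    unfolding has_fps_expansion_def
    using less_le_trans[OF _ F, of 0] eventually_nhds_in_open[of "ball 0 1" "0::complex"]
    by (auto simp: ev elim!: eventually_mono)
  then show "taylor_coeff f = a"
    using fps_nth_fps_expansion[of f "Abs_fps a"] by (simp add: taylor_coeff_def fun_eq_iff)
qed

section \<open>The upper bound for composition\<close>

context inner_function
begin

text \<open>A general \<open>f\<close> has no values on the circle, so Bessel and Schur are applied
  to its Taylor polynomials \<open>P N\<close>. The bound is uniform in \<open>N\<close> and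
  \<open>K\<close>; first \<open>N\<close> and then \<open>K\<close> tends to infinity.\<close>

lemma composition_bound:
  assumes self: "\<phi> ` ball 0 1 \<subseteq> ball 0 1" and f: "f holomorphic_on ball 0 1"
    and sm: "summable (\<lambda>n. (norm (taylor_coeff f n))\<^sup>2)"
  shows "summable (\<lambda>n. (norm (taylor_coeff (f \<circ> \<phi>) n))\<^sup>2)" (is ?S)
    and "(\<Sum>n. (norm (taylor_coeff (f \<circ> \<phi>) n))\<^sup>2)
      \<le> (1 + norm (\<phi> 0)) / (1 - norm (\<phi> 0)) * (\<Sum>n. (norm (taylor_coeff f n))\<^sup>2)" (is ?B)
proof -
  define a where "a = taylor_coeff f"
  define P where "P N z = (\<Sum>n<N. a n * z ^ n)" for N z
  define C where "C = (1 + norm (\<phi> 0)) / (1 - norm (\<phi> 0))"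
  have b: "norm (\<phi> 0) < 1"
    using self by (auto simp: image_subset_iff)
  then have "C \<ge> 0"
    by (simp add: C_def)
  have poly: "(\<Sum>k<K. (norm (taylor_coeff (P N \<circ> \<phi>) k))\<^sup>2) \<le> C * (\<Sum>n. (norm (a n))\<^sup>2)" for K N
  proof -
    have "(\<Sum>k<K. (norm (taylor_coeff (P N \<circ> \<phi>) k))\<^sup>2)
        \<le> Re (\<Sum>m<N. \<Sum>n<N. a m * cnj (a n) * toeplitz_kernel (\<phi> 0) m n)"
    proof (rule bessel_inequality)
      show "continuous_on (cball 0 1) (P N \<circ> \<phi>)"
        unfolding P_def o_def by (intro continuous_intros cont)
      show "(P N \<circ> \<phi>) holomorphic_on ball 0 1"
        unfolding P_def o_def by (intro holomorphic_intros hol)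
    qed (use has_integral_norm_square_sum[where N = N and a = a] in \<open>simp add: P_def\<close>)
    also have "\<dots> \<le> C * (\<Sum>n<N. (norm (a n))\<^sup>2)"
      unfolding C_def using b by (rule schur_test_toeplitz_kernel)
    also have "\<dots> \<le> C * (\<Sum>n. (norm (a n))\<^sup>2)"
      using sm \<open>C \<ge> 0\<close> by (intro mult_left_mono sum_le_suminf) (auto simp: a_def)
    finally show ?thesis .
  qed
  \<comment> \<open>Any compact neighbourhood of 0 would serve. Its image stays in a disc of radius
    \<open>r < 1\<close>, where the Taylor series of \<open>f\<close> converges uniformly.\<close>
  obtain r where r: "r < 1" "\<And>z. z \<in> cball 0 (1/2) \<Longrightarrow> norm (\<phi> z) \<le> r"
  proof -
    have "continuous_on (cball 0 (1/2)) (\<lambda>z. norm (\<phi> z))"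
      by (intro continuous_intros continuous_on_subset[OF cont]) auto
    then obtain x where "x \<in> cball 0 (1/2)" "\<And>z. z \<in> cball 0 (1/2) \<Longrightarrow> norm (\<phi> z) \<le> norm (\<phi> x)"
      using continuous_attains_sup[of "cball 0 (1/2) :: complex set" "\<lambda>z. norm (\<phi> z)"] by auto
    moreover from this have "norm (\<phi> x) < 1"
      using self by (auto simp: image_subset_iff)
    ultimately show ?thesis
      using that by blast
  qed
  have "1 \<le> conv_radius a"
    unfolding a_def using holomorphic_taylor_sums[OF f] by (intro one_le_conv_radius) (auto simp: sums_iff)
  then have "ereal r < conv_radius a"
    using r(1) by (metis ereal_less(3) less_le_trans one_ereal_def less_ereal.simps(1))
  from powser_uniform_limit[OF this, of 0]
  have "uniform_limit (cball 0 r) P (\<lambda>z. \<Sum>n. a n * z ^ n) sequentially"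
    by (simp add: P_def[abs_def])
  then have "uniform_limit (cball 0 r) P f sequentially"
    by (rule uniform_limit_cong'[THEN iffD1, rotated -1])
      (use r(1) holomorphic_taylor_sums[OF f] in \<open>auto simp: a_def sums_iff\<close>)
  then have "uniform_limit (ball 0 (1/2)) (\<lambda>N. P N \<circ> \<phi>) (f \<circ> \<phi>) sequentially"
    unfolding o_def by (rule uniform_limit_compose') (use r(2) in auto)
  \<comment> \<open>Weierstrass: uniform convergence near 0 carries over to all derivatives at
    0.\<close>
  then have "(\<lambda>N. (deriv ^^ k) (P N \<circ> \<phi>) 0) \<longlonglongrightarrow> (deriv ^^ k) (f \<circ> \<phi>) 0" for k
    by (rule higher_deriv_complex_uniform_limit)
      (auto simp: P_def o_def intro!: always_eventually holomorphic_intros holomorphic_on_subset[OF hol])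
  then have "(\<lambda>N. taylor_coeff (P N \<circ> \<phi>) k) \<longlonglongrightarrow> taylor_coeff (f \<circ> \<phi>) k" for k
    unfolding taylor_coeff_def by (intro tendsto_intros) auto
  then have "(\<lambda>N. \<Sum>k<K. (norm (taylor_coeff (P N \<circ> \<phi>) k))\<^sup>2) \<longlonglongrightarrow> (\<Sum>k<K. (norm (taylor_coeff (f \<circ> \<phi>) k))\<^sup>2)" for K
    by (intro tendsto_intros)
  then have bound: "(\<Sum>k<K. (norm (taylor_coeff (f \<circ> \<phi>) k))\<^sup>2) \<le> C * (\<Sum>n. (norm (a n))\<^sup>2)" for K
    by (rule LIMSEQ_le_const2) (use poly in blast)
  show ?S
    by (rule summableI_nonneg_bounded[OF _ bound]) simp
  then show ?B
    using bound unfolding C_def a_def by (rule suminf_le_const)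
qed

end

section \<open>Disc automorphisms\<close>

text \<open>Bracketed like the formula for \<open>\<Psi>\<close>, so that both components of
  \<open>\<Psi> Z\<close> are instances of it.\<close>

definition disc_automorphism :: "complex \<Rightarrow> complex \<Rightarrow> complex \<Rightarrow> complex" where
  "disc_automorphism l w z = l * ((z + w) / (1 + cnj w * z))"

lemma disc_automorphism_denominator:
  assumes "norm w < 1" "norm z \<le> 1"
  shows "1 + cnj w * z \<noteq> 0"
proof
  assume "1 + cnj w * z = 0"
  then have "norm (cnj w * z) = 1"
    by (metis add_eq_0_iff norm_minus_cancel norm_one)
  moreover have "norm (cnj w * z) \<le> norm w * 1"
    using assms by (simp add: norm_mult mult_left_le)
  ultimately show False
    using assms by simp
qed

text \<open>The right side is positive for \<open>z\<close> and \<open>w\<close> in the disc and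
  vanishes for \<open>z\<close> on the circle, which gives both the self-map property and
  unimodularity.\<close>

lemma disc_automorphism_norm:
  "(norm (1 + cnj w * z))\<^sup>2 - (norm (z + w))\<^sup>2 = (1 - (norm z)\<^sup>2) * (1 - (norm w)\<^sup>2)"
  by (simp only: cmod_power2) (simp add: power2_eq_square algebra_simps)

lemma norm_disc_automorphism_less:
  assumes "norm l = 1" "norm w < 1" "norm z < 1"
  shows "norm (disc_automorphism l w z) < 1"
proof -
  have "(norm (1 + cnj w * z))\<^sup>2 - (norm (z + w))\<^sup>2 > 0"
    unfolding disc_automorphism_norm using assms by (intro mult_pos_pos) (auto simp: power_less_one_iff)
  then have "norm (z + w) < norm (1 + cnj w * z)"
    by (simp add: power2_less_imp_less)
  then show ?thesis
    using assms by (simp add: disc_automorphism_def norm_mult norm_divide divide_less_eq)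
qed

lemma inner_function_disc_automorphism:
  assumes "norm l = 1" "norm w < 1"
  shows "inner_function (disc_automorphism l w)"
proof
  show "continuous_on (cball 0 1) (disc_automorphism l w)"
    unfolding disc_automorphism_def[abs_def]
    by (intro continuous_intros ballI disc_automorphism_denominator assms) auto
  show "disc_automorphism l w holomorphic_on ball 0 1"
    unfolding disc_automorphism_def[abs_def]
    by (intro holomorphic_intros disc_automorphism_denominator assms) auto
  show "norm (disc_automorphism l w z) = 1" if "norm z = 1" for z
  proof -
    have "(norm (1 + cnj w * z))\<^sup>2 - (norm (z + w))\<^sup>2 = 0"
      using that by (simp add: disc_automorphism_norm)
    then have "norm (z + w) = norm (1 + cnj w * z)"
      by (simp add: power2_eq_iff_nonneg)
    then show ?thesis
      using assms disc_automorphism_denominator[of w z] that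
      by (simp add: disc_automorphism_def norm_mult norm_divide)
  qed
qed

text \<open>The inverse lies in the same family, and its parameter \<open>- (l * w)\<close> has the
  modulus of \<open>w\<close>. Numerator and denominator of the composite share the factor
  \<open>(1 - w * cnj w) / D\<close>, which cancels.\<close>

lemma disc_automorphism_inverse:
  assumes "norm l = 1" "norm w < 1" "norm z < 1"
  shows "disc_automorphism l w (disc_automorphism (cnj l) (- (l * w)) z) = z"
proof -
  have l: "l * cnj l = 1" "l \<noteq> 0"
    using assms(1) by (auto simp: unit_mult_cnj)
  have d: "1 + cnj (- (l * w)) * z \<noteq> 0"
    using assms by (intro disc_automorphism_denominator) (auto simp: norm_mult)
  define D where "D = 1 - cnj l * cnj w * z"
  have D: "D \<noteq> 0" using d by (simp add: D_def)
  have w: "1 - w * cnj w \<noteq> 0"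
  proof -
    have "norm w ^ 2 < 1"
      using assms by (simp add: power_less_one_iff)
    then show ?thesis
      by (metis complex_norm_square eq_iff_diff_eq_0 less_irrefl of_real_eq_1_iff)
  qed
  have psi: "disc_automorphism (cnj l) (- (l * w)) z = (cnj l * z - w) / D"
    using l by (simp add: disc_automorphism_def D_def field_simps)
  have "(cnj l * z - w) / D + w = cnj l * z * (1 - w * cnj w) / D"
    using D by (simp add: field_simps) (simp add: D_def algebra_simps)
  moreover have "1 + cnj w * ((cnj l * z - w) / D) = (1 - w * cnj w) / D"
    using D by (simp add: field_simps) (simp add: D_def algebra_simps)
  ultimately have "disc_automorphism l w ((cnj l * z - w) / D)
      = l * ((cnj l * z * (1 - w * cnj w) / D) / ((1 - w * cnj w) / D))"
    by (simp only: disc_automorphism_def)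
  also have "\<dots> = l * cnj l * z"
    using D w by simp
  finally show ?thesis
    using l psi by simp
qed

lemma taylor_coeff_cong:
  assumes "\<And>z. norm z < 1 \<Longrightarrow> f z = g z"
  shows "taylor_coeff f = taylor_coeff g"
proof
  fix k
  have "eventually (\<lambda>z. f z = g z) (nhds 0)"
    using eventually_nhds_in_open[of "ball 0 (1::real)" 0] assms
    by (auto elim!: eventually_mono simp: eventually_nhds_metric dist_norm intro!: exI[of _ 1])
  then show "taylor_coeff f k = taylor_coeff g k"
    unfolding taylor_coeff_def by (simp add: higher_deriv_cong_ev)
qed

text \<open>For the lower bound, \<open>composition_bound\<close> is applied to \<open>g\<close> and
  the inverse \<open>?\<psi>\<close>: \<open>g \<circ> ?\<psi>\<close> agrees with \<open>f\<close>
  on the disc, and the constant is the same because \<open>?\<psi> 0\<close> also has modulus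
  \<open>norm w\<close>.\<close>

lemma disc_automorphism_composition:
  assumes l: "norm l = 1" and w: "norm w < 1" and f: "f holomorphic_on ball 0 1"
    and sm: "summable (\<lambda>n. (norm (taylor_coeff f n))\<^sup>2)"
  defines "g \<equiv> f \<circ> disc_automorphism l w"
  shows "g holomorphic_on ball 0 1"
    and "summable (\<lambda>n. (norm (taylor_coeff g n))\<^sup>2)"
    and "(\<Sum>n. (norm (taylor_coeff g n))\<^sup>2) \<le> (1 + norm w) / (1 - norm w) * (\<Sum>n. (norm (taylor_coeff f n))\<^sup>2)"
    and "(1 - norm w) / (1 + norm w) * (\<Sum>n. (norm (taylor_coeff f n))\<^sup>2) \<le> (\<Sum>n. (norm (taylor_coeff g n))\<^sup>2)"
proof -
  let ?\<phi> = "disc_automorphism l w" and ?\<psi> = "disc_automorphism (cnj l) (- (l * w))"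
  have lw: "norm (cnj l) = 1" "norm (- (l * w)) < 1"
    using l w by (auto simp: norm_mult)
  interpret \<phi>: inner_function ?\<phi>
    using l w by (rule inner_function_disc_automorphism)
  interpret \<psi>: inner_function ?\<psi>
    using lw by (rule inner_function_disc_automorphism)
  have self: "?\<phi> ` ball 0 1 \<subseteq> ball 0 1" "?\<psi> ` ball 0 1 \<subseteq> ball 0 1"
    using norm_disc_automorphism_less[OF l w] norm_disc_automorphism_less[OF lw] by auto
  have zero: "norm (?\<phi> 0) = norm w" "norm (?\<psi> 0) = norm w"
    using l by (simp_all add: disc_automorphism_def norm_mult)
  show g: "g holomorphic_on ball 0 1"
    unfolding g_def using \<phi>.hol f self(1) by (rule holomorphic_on_compose_gen)
  show sm_g: "summable (\<lambda>n. (norm (taylor_coeff g n))\<^sup>2)"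
    and "(\<Sum>n. (norm (taylor_coeff g n))\<^sup>2) \<le> (1 + norm w) / (1 - norm w) * (\<Sum>n. (norm (taylor_coeff f n))\<^sup>2)"
    using \<phi>.composition_bound[OF self(1) f sm] by (simp_all add: g_def zero)
  have "taylor_coeff (g \<circ> ?\<psi>) = taylor_coeff f"
    by (rule taylor_coeff_cong) (simp add: g_def disc_automorphism_inverse l w)
  then have "(\<Sum>n. (norm (taylor_coeff f n))\<^sup>2) \<le> (1 + norm w) / (1 - norm w) * (\<Sum>n. (norm (taylor_coeff g n))\<^sup>2)"
    using \<psi>.composition_bound(2)[OF self(2) g sm_g] by (simp add: zero)
  then show "(1 - norm w) / (1 + norm w) * (\<Sum>n. (norm (taylor_coeff f n))\<^sup>2) \<le> (\<Sum>n. (norm (taylor_coeff g n))\<^sup>2)"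
    using w by (simp add: field_simps add_pos_nonneg)
qed

section \<open>Idempotent components\<close>

lemma bc_comp_simps [simp]:
  "bc_comp1 0 = 0" "bc_comp2 0 = 0"
  "bc_comp1 (Z + W) = bc_comp1 Z + bc_comp1 W" "bc_comp2 (Z + W) = bc_comp2 Z + bc_comp2 W"
  "bc_comp1 (Z - W) = bc_comp1 Z - bc_comp1 W" "bc_comp2 (Z - W) = bc_comp2 Z - bc_comp2 W"
  "bc_comp1 (r *\<^sub>R Z) = r *\<^sub>R bc_comp1 Z" "bc_comp2 (r *\<^sub>R Z) = r *\<^sub>R bc_comp2 Z"
  "bc_comp1 (bc_cnj3 Z) = cnj (bc_comp1 Z)" "bc_comp2 (bc_cnj3 Z) = cnj (bc_comp2 Z)"
  by (simp_all add: bc_comp1_def bc_comp2_def scaleR_bicomplex_def bc_cnj3_def algebra_simps)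

lemma bc_comp_idem_simps [simp]:
  "bc_comp1 (Z / W) = bc_comp1 Z / bc_comp1 W" "bc_comp2 (Z / W) = bc_comp2 Z / bc_comp2 W"
  "bc_comp1 (bc_mod Z) = of_real (norm (bc_comp1 Z))"
  "bc_comp2 (bc_mod Z) = of_real (norm (bc_comp2 Z))"
  "bc_comp1 (hyp_sqrt Z) = of_real (sqrt (Re (bc_comp1 Z)))"
  "bc_comp2 (hyp_sqrt Z) = of_real (sqrt (Re (bc_comp2 Z)))"
  by (simp_all add: divide_bicomplex_def bc_mod_def hyp_sqrt_def)

lemma bc_comp_power [simp]: "bc_comp1 (Z ^ n) = bc_comp1 Z ^ n" "bc_comp2 (Z ^ n) = bc_comp2 Z ^ n"
  by (induction n) simp_all

lemma bc_comp_sum [simp]: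
  "bc_comp1 (sum a A) = (\<Sum>x\<in>A. bc_comp1 (a x))" "bc_comp2 (sum a A) = (\<Sum>x\<in>A. bc_comp2 (a x))"
  by (induction A rule: infinite_finite_induct) simp_all

lemma bc_eqI: "bc_comp1 Z = bc_comp1 W \<Longrightarrow> bc_comp2 Z = bc_comp2 W \<Longrightarrow> Z = W"
  by (metis bc_idem_comp)

text \<open>The parallelogram law for \<open>z - \<i> * w\<close> and \<open>z + \<i> * w\<close>.
  It makes the Euclidean topology the product topology of the two components.\<close>

lemma bc_norm_square: "(norm Z)\<^sup>2 = ((norm (bc_comp1 Z))\<^sup>2 + (norm (bc_comp2 Z))\<^sup>2) / 2"
proof -
  have "(norm (bc_comp1 Z))\<^sup>2 + (norm (bc_comp2 Z))\<^sup>2 = 2 * ((norm (bc_re Z))\<^sup>2 + (norm (bc_im Z))\<^sup>2)"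
    unfolding cmod_power2 by (simp add: bc_comp1_def bc_comp2_def power2_eq_square algebra_simps)
  then show ?thesis
    by (simp add: norm_bicomplex_def)
qed

lemma norm_bc_comp_le: "norm (bc_comp1 Z) \<le> 2 * norm Z" "norm (bc_comp2 Z) \<le> 2 * norm Z"
proof -
  have four: "(2 * norm Z)\<^sup>2 = 4 * (norm Z)\<^sup>2"
    by (simp add: power_mult_distrib)
  have "(norm (bc_comp1 Z))\<^sup>2 + (norm (bc_comp2 Z))\<^sup>2 = 2 * (norm Z)\<^sup>2"
    by (simp add: bc_norm_square)
  also have "\<dots> \<le> (2 * norm Z)\<^sup>2"
    unfolding four by (intro mult_right_mono) auto
  finally have "(norm (bc_comp1 Z))\<^sup>2 + (norm (bc_comp2 Z))\<^sup>2 \<le> (2 * norm Z)\<^sup>2" .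
  then have "(norm (bc_comp1 Z))\<^sup>2 \<le> (2 * norm Z)\<^sup>2" "(norm (bc_comp2 Z))\<^sup>2 \<le> (2 * norm Z)\<^sup>2"
    using zero_le_power2[of "norm (bc_comp1 Z)"] zero_le_power2[of "norm (bc_comp2 Z)"] by linarith+
  then show "norm (bc_comp1 Z) \<le> 2 * norm Z" "norm (bc_comp2 Z) \<le> 2 * norm Z"
    by (auto intro: power2_le_imp_le)
qed

lemma bounded_linear_bc_comp1: "bounded_linear bc_comp1"
  by (rule bounded_linear_intro[where K = 2]) (simp_all add: norm_bc_comp_le mult.commute[of _ 2])

lemma bounded_linear_bc_comp2: "bounded_linear bc_comp2"
  by (rule bounded_linear_intro[where K = 2]) (simp_all add: norm_bc_comp_le mult.commute[of _ 2])

lemma bounded_linear_bc_idem: "bounded_linear (\<lambda>p. bc_idem (fst p) (snd p))"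
proof (rule bounded_linear_intro[where K = 1])
  show "norm (bc_idem (fst p) (snd p)) \<le> norm p * 1" for p
    by (rule power2_le_imp_le) (auto simp: bc_norm_square norm_prod_def)
qed (auto intro!: bc_eqI)

lemma tendsto_bc_idem:
  "(f \<longlongrightarrow> x) F \<Longrightarrow> (g \<longlongrightarrow> y) F \<Longrightarrow> ((\<lambda>t. bc_idem (f t) (g t)) \<longlongrightarrow> bc_idem x y) F"
  using bounded_linear.tendsto[OF bounded_linear_bc_idem, OF tendsto_Pair] by simp

text \<open>Both the component maps and \<open>bc_idem\<close> are bounded linear, so limits pass in
  either direction.\<close>

lemma bc_sums_iff:
  "a sums s \<longleftrightarrow> (\<lambda>n. bc_comp1 (a n)) sums bc_comp1 s \<and> (\<lambda>n. bc_comp2 (a n)) sums bc_comp2 s"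
proof safe
  assume "(\<lambda>n. bc_comp1 (a n)) sums bc_comp1 s" "(\<lambda>n. bc_comp2 (a n)) sums bc_comp2 s"
  from tendsto_bc_idem[OF this[unfolded sums_def]]
  have "(\<lambda>n. bc_idem (bc_comp1 (sum a {..<n})) (bc_comp2 (sum a {..<n}))) \<longlonglongrightarrow> s"
    by simp
  then show "a sums s"
    by (simp only: sums_def bc_idem_comp)
qed (auto intro: bounded_linear.sums bounded_linear_bc_comp1 bounded_linear_bc_comp2)

lemma bc_disc_iff: "Z \<in> bc_disc \<longleftrightarrow> norm (bc_comp1 Z) < 1 \<and> norm (bc_comp2 Z) < 1"
proof
  assume "norm (bc_comp1 Z) < 1 \<and> norm (bc_comp2 Z) < 1"
  then show "Z \<in> bc_disc"
    unfolding bc_disc_def using bc_idem_comp[of Z, symmetric] by blast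
qed (auto simp: bc_disc_def)

lemma hyp_le_idem_iff:
  "bc_idem (of_real a1) (of_real a2) \<preceq> bc_idem (of_real b1) (of_real b2) \<longleftrightarrow> a1 \<le> b1 \<and> a2 \<le> b2"
proof -
  have diff: "bc_idem (of_real b1) (of_real b2) - bc_idem (of_real a1) (of_real a2)
      = bc_idem (of_real (b1 - a1)) (of_real (b2 - a2))"
    by (rule bc_eqI) simp_all
  have inj: "bc_idem (of_real x) (of_real y) = bc_idem (of_real x') (of_real y') \<longleftrightarrow> x = x' \<and> y = y'"
    for x y x' y' :: real
    by (metis bc_comp_idem of_real_eq_iff)
  show ?thesis
    unfolding hyp_le_def hyp_nonneg_def diff mem_Collect_eq inj by force
qed

lemma bc_idem_mult_of_real:
  "bc_idem (of_real a1) (of_real a2) * bc_idem (of_real b1) (of_real b2)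
    = bc_idem (of_real (a1 * b1)) (of_real (a2 * b2))"
  by (rule bc_eqI) simp_all

lemma hyp_sqrt_mod_quotient:
  "hyp_sqrt ((1 - bc_mod Z) / (1 + bc_mod Z)) =
     bc_idem (of_real (sqrt ((1 - norm (bc_comp1 Z)) / (1 + norm (bc_comp1 Z)))))
       (of_real (sqrt ((1 - norm (bc_comp2 Z)) / (1 + norm (bc_comp2 Z)))))"
  "hyp_sqrt ((1 + bc_mod Z) / (1 - bc_mod Z)) =
     bc_idem (of_real (sqrt ((1 + norm (bc_comp1 Z)) / (1 - norm (bc_comp1 Z)))))
       (of_real (sqrt ((1 + norm (bc_comp2 Z)) / (1 - norm (bc_comp2 Z)))))"
proof -
  have "Re ((1 - of_real x) / (1 + of_real x)) = (1 - x) / (1 + x)"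
    "Re ((1 + of_real x) / (1 - of_real x)) = (1 + x) / (1 - x)" for x :: real
    using Re_complex_of_real[of "(1 - x) / (1 + x)"] Re_complex_of_real[of "(1 + x) / (1 - x)"]
    unfolding of_real_divide of_real_add of_real_diff of_real_1 by this+
  then show "hyp_sqrt ((1 - bc_mod Z) / (1 + bc_mod Z)) =
     bc_idem (of_real (sqrt ((1 - norm (bc_comp1 Z)) / (1 + norm (bc_comp1 Z)))))
       (of_real (sqrt ((1 - norm (bc_comp2 Z)) / (1 + norm (bc_comp2 Z)))))"
    "hyp_sqrt ((1 + bc_mod Z) / (1 - bc_mod Z)) =
     bc_idem (of_real (sqrt ((1 + norm (bc_comp1 Z)) / (1 - norm (bc_comp1 Z)))))
       (of_real (sqrt ((1 + norm (bc_comp2 Z)) / (1 - norm (bc_comp2 Z)))))"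
    by (simp_all add: hyp_sqrt_def)
qed

section \<open>Functions on the bicomplex disc through their components\<close>

text \<open>The functions \<open>F\<close> and \<open>G\<close> are the $f_1$ and $f_2$ of the idempotent representation of $f$.\<close>

definition bc_components :: "(bicomplex \<Rightarrow> bicomplex) \<Rightarrow> (complex \<Rightarrow> complex) \<Rightarrow> (complex \<Rightarrow> complex) \<Rightarrow> bool" where
  "bc_components f F G \<longleftrightarrow> F holomorphic_on ball 0 1 \<and> G holomorphic_on ball 0 1 \<and>
     (\<forall>Z\<in>bc_disc. f Z = bc_idem (F (bc_comp1 Z)) (G (bc_comp2 Z)))"

lemma bc_power_series_imp_components:
  assumes "bc_power_series_on_disc f a"
  obtains F G where "bc_components f F G"
proof
  \<comment> \<open>Setting the other component to 0 loses nothing: each component of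
    \<open>f Z\<close> is the sum of a power series in the same component of \<open>Z\<close>
    alone.\<close>
  let ?F = "\<lambda>z. bc_comp1 (f (bc_idem z 0))" and ?G = "\<lambda>z. bc_comp2 (f (bc_idem 0 z))"
  have sums: "(\<lambda>n. bc_comp1 (a n) * bc_comp1 Z ^ n) sums bc_comp1 (f Z)"
    "(\<lambda>n. bc_comp2 (a n) * bc_comp2 Z ^ n) sums bc_comp2 (f Z)" if "Z \<in> bc_disc" for Z
    using assms that by (auto simp: bc_power_series_on_disc_def bc_sums_iff)
  have F: "(\<lambda>n. bc_comp1 (a n) * z ^ n) sums ?F z" and G: "(\<lambda>n. bc_comp2 (a n) * z ^ n) sums ?G z"
    if "norm z < 1" for z
    using sums(1)[of "bc_idem z 0"] sums(2)[of "bc_idem 0 z"] that by (simp_all add: bc_disc_iff)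
  have "f Z = bc_idem (?F (bc_comp1 Z)) (?G (bc_comp2 Z))" if "Z \<in> bc_disc" for Z
    using sums[OF that] F[of "bc_comp1 Z"] G[of "bc_comp2 Z"] that
    by (intro bc_eqI) (auto simp: bc_disc_iff intro: sums_unique2)
  then show "bc_components f ?F ?G"
    using taylor_coeff_unique(1)[OF F] taylor_coeff_unique(1)[OF G] by (simp add: bc_components_def)
qed

text \<open>Testing at the diagonal points \<open>bc_idem z z\<close> reduces uniqueness of the
  coefficients to the complex case. This also justifies the \<open>THE\<close> in
  \<open>bc_coeffs\<close>.\<close>

lemma bc_power_series_iff_components:
  assumes "bc_components f F G"
  shows "bc_power_series_on_disc f a \<longleftrightarrow> a = (\<lambda>n. bc_idem (taylor_coeff F n) (taylor_coeff G n))"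
proof
  assume a: "bc_power_series_on_disc f a"
  have "(\<lambda>n. bc_comp1 (a n) * z ^ n) sums F z" "(\<lambda>n. bc_comp2 (a n) * z ^ n) sums G z" if "norm z < 1" for z
  proof -
    have "bc_idem z z \<in> bc_disc"
      using that by (simp add: bc_disc_iff)
    then have "(\<lambda>n. a n * bc_idem z z ^ n) sums f (bc_idem z z)" "f (bc_idem z z) = bc_idem (F z) (G z)"
      using a assms by (auto simp: bc_power_series_on_disc_def bc_components_def)
    then show "(\<lambda>n. bc_comp1 (a n) * z ^ n) sums F z" "(\<lambda>n. bc_comp2 (a n) * z ^ n) sums G z"
      by (simp_all add: bc_sums_iff)
  qed
  then have "taylor_coeff F = (\<lambda>n. bc_comp1 (a n))" "taylor_coeff G = (\<lambda>n. bc_comp2 (a n))"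
    by (auto intro: taylor_coeff_unique(2))
  then show "a = (\<lambda>n. bc_idem (taylor_coeff F n) (taylor_coeff G n))"
    by simp
next
  assume "a = (\<lambda>n. bc_idem (taylor_coeff F n) (taylor_coeff G n))"
  then show "bc_power_series_on_disc f a"
    using assms holomorphic_taylor_sums
    by (auto simp: bc_power_series_on_disc_def bc_components_def bc_sums_iff bc_disc_iff)
qed

text \<open>Unit increments have two nonzero components, so the limits are punctured and compose
  with complex difference quotients.\<close>

lemma filterlim_bc_comp_units:
  "filterlim bc_comp1 (at 0) (at 0 within {H. H dvd 1})"
  "filterlim bc_comp2 (at 0) (at 0 within {H. H dvd 1})"
  using bounded_linear.tendsto[OF bounded_linear_bc_comp1, of "\<lambda>H. H" 0 "at 0 within {H. H dvd 1}"]
    bounded_linear.tendsto[OF bounded_linear_bc_comp2, of "\<lambda>H. H" 0 "at 0 within {H. H dvd 1}"]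
  by (auto simp: filterlim_at eventually_at_filter bicomplex_dvd_one_iff)

lemma eventually_in_bc_disc:
  assumes "Z \<in> bc_disc"
  shows "eventually (\<lambda>H. Z + H \<in> bc_disc) (at 0 within A)"
proof -
  have "((\<lambda>H. bc_comp1 (Z + H)) \<longlongrightarrow> bc_comp1 (Z + 0)) (at 0 within A)"
    "((\<lambda>H. bc_comp2 (Z + H)) \<longlongrightarrow> bc_comp2 (Z + 0)) (at 0 within A)"
    by (intro bounded_linear.tendsto[OF bounded_linear_bc_comp1]
        bounded_linear.tendsto[OF bounded_linear_bc_comp2] tendsto_intros)+
  then have "eventually (\<lambda>H. norm (bc_comp1 (Z + H)) < 1) (at 0 within A)"
    "eventually (\<lambda>H. norm (bc_comp2 (Z + H)) < 1) (at 0 within A)"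
    using assms by (auto intro!: order_tendstoD(2)[OF tendsto_norm] simp: bc_disc_iff)
  then show ?thesis
    by eventually_elim (simp add: bc_disc_iff)
qed

lemma bc_components_holomorphic:
  assumes "bc_components f F G"
  shows "bc_holomorphic_on f bc_disc"
  unfolding bc_holomorphic_on_def
proof
  fix Z assume Z: "Z \<in> bc_disc"
  let ?U = "at 0 within {H :: bicomplex. H dvd 1}"
  obtain D E where D: "(F has_field_derivative D) (at (bc_comp1 Z))"
    and E: "(G has_field_derivative E) (at (bc_comp2 Z))"
    using assms Z unfolding bc_components_def bc_disc_iff
    by (metis at_within_open field_differentiable_def holomorphic_on_def mem_ball_0 open_ball)
  have D': "((\<lambda>H. (F (bc_comp1 Z + bc_comp1 H) - F (bc_comp1 Z)) / bc_comp1 H) \<longlongrightarrow> D) ?U"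
    by (rule filterlim_compose[OF D[unfolded DERIV_def] filterlim_bc_comp_units(1)])
  have E': "((\<lambda>H. (G (bc_comp2 Z + bc_comp2 H) - G (bc_comp2 Z)) / bc_comp2 H) \<longlongrightarrow> E) ?U"
    by (rule filterlim_compose[OF E[unfolded DERIV_def] filterlim_bc_comp_units(2)])
  have "((\<lambda>H. (f (Z + H) - f Z) / H) \<longlongrightarrow> bc_idem D E) ?U"
  proof (rule Lim_transform_eventually[OF tendsto_bc_idem[OF D' E']])
    show "\<forall>\<^sub>F H in ?U. bc_idem ((F (bc_comp1 Z + bc_comp1 H) - F (bc_comp1 Z)) / bc_comp1 H)
        ((G (bc_comp2 Z + bc_comp2 H) - G (bc_comp2 Z)) / bc_comp2 H) = (f (Z + H) - f Z) / H"
      \<comment> \<open>The representation by \<open>F\<close> and \<open>G\<close> holds only on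
        \<open>bc_disc\<close>, so the quotients agree only once \<open>Z + H\<close> lies
        there.\<close>
      using eventually_in_bc_disc[OF Z]
    proof eventually_elim
      case (elim H)
      then show ?case
        using assms Z by (intro bc_eqI) (simp_all add: bc_components_def)
    qed
  qed
  then show "bc_differentiable f Z"
    unfolding bc_differentiable_def by blast
qed

lemma bc_coeffs_components:
  assumes "bc_components f F G"
  shows "bc_coeffs f = (\<lambda>n. bc_idem (taylor_coeff F n) (taylor_coeff G n))"
  unfolding bc_coeffs_def by (rule the_equality) (simp_all add: bc_power_series_iff_components[OF assms])

lemma bc_summable_iff:
  "summable a \<longleftrightarrow> summable (\<lambda>n. bc_comp1 (a n)) \<and> summable (\<lambda>n. bc_comp2 (a n))"
proof safe
  assume "summable (\<lambda>n. bc_comp1 (a n))" "summable (\<lambda>n. bc_comp2 (a n))"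
  then show "summable a"
    unfolding summable_def by (metis bc_comp_idem bc_sums_iff)
qed (auto simp: summable_def bc_sums_iff)

text \<open>Holomorphy and the power series already follow from the components, so only square
  summability remains.\<close>

lemma bc_hardy2_components:
  assumes "bc_components f F G"
  shows "f \<in> bc_hardy2 \<longleftrightarrow> summable (\<lambda>n. (norm (taylor_coeff F n))\<^sup>2) \<and> summable (\<lambda>n. (norm (taylor_coeff G n))\<^sup>2)"
  using bc_power_series_iff_components[OF assms] bc_components_holomorphic[OF assms]
  by (simp add: bc_hardy2_def bc_summable_iff summable_of_real_iff flip: of_real_power)

lemma bc_hardy2_norm_components:
  assumes "bc_components f F G"
    and "summable (\<lambda>n. (norm (taylor_coeff F n))\<^sup>2)" "summable (\<lambda>n. (norm (taylor_coeff G n))\<^sup>2)"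
  shows "bc_hardy2_norm f = bc_idem (of_real (sqrt (\<Sum>n. (norm (taylor_coeff F n))\<^sup>2)))
    (of_real (sqrt (\<Sum>n. (norm (taylor_coeff G n))\<^sup>2)))"
proof -
  have "(\<lambda>n. (bc_mod (bc_coeffs f n))\<^sup>2) sums bc_idem (of_real (\<Sum>n. (norm (taylor_coeff F n))\<^sup>2))
    (of_real (\<Sum>n. (norm (taylor_coeff G n))\<^sup>2))"
    using assms(2,3)
    by (simp add: bc_coeffs_components[OF assms(1)] bc_sums_iff sums_of_real_iff summable_sums flip: of_real_power)
  then show ?thesis
    by (simp add: bc_hardy2_norm_def sums_iff hyp_sqrt_def)
qed

theorem theorem3p6:
  fixes lam W :: bicomplex and \<Psi> f :: "bicomplex \<Rightarrow> bicomplex"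
  assumes "bc_mod lam = 1"
    and "W \<in> bc_disc"
    and "\<And>Z. Z \<in> bc_disc \<Longrightarrow> \<Psi> Z = lam * ((Z + W) / (1 + bc_cnj3 W * Z))"
    and "f \<in> bc_hardy2"
  shows "bc_comp_op \<Psi> f \<in> bc_hardy2
       \<and> hyp_sqrt ((1 - bc_mod (\<Psi> 0)) / (1 + bc_mod (\<Psi> 0))) * bc_hardy2_norm f
           \<preceq> bc_hardy2_norm (bc_comp_op \<Psi> f)
       \<and> bc_hardy2_norm (bc_comp_op \<Psi> f)
           \<preceq> hyp_sqrt ((1 + bc_mod (\<Psi> 0)) / (1 - bc_mod (\<Psi> 0))) * bc_hardy2_norm f"
proof -
  define l1 l2 w1 w2 where defs: "l1 = bc_comp1 lam" "l2 = bc_comp2 lam" "w1 = bc_comp1 W" "w2 = bc_comp2 W"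
  have l: "norm l1 = 1" "norm l2 = 1"
    using arg_cong[OF assms(1), of bc_comp1] arg_cong[OF assms(1), of bc_comp2]
    by (simp_all add: defs)
  have w: "norm w1 < 1" "norm w2 < 1"
    using assms(2) by (simp_all add: defs bc_disc_iff)
  have \<Psi>: "bc_comp1 (\<Psi> Z) = disc_automorphism l1 w1 (bc_comp1 Z)"
    "bc_comp2 (\<Psi> Z) = disc_automorphism l2 w2 (bc_comp2 Z)" if "Z \<in> bc_disc" for Z
    by (simp_all add: assms(3)[OF that] disc_automorphism_def defs)
  have "0 \<in> bc_disc"
    by (simp add: bc_disc_iff)
  then have \<Psi>0: "norm (bc_comp1 (\<Psi> 0)) = norm w1" "norm (bc_comp2 (\<Psi> 0)) = norm w2"
    by (simp_all add: \<Psi> disc_automorphism_def norm_mult l)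
  obtain F G where comp: "bc_components f F G"
    using assms(4) unfolding bc_hardy2_def by (blast elim: bc_power_series_imp_components)
  then have FG: "F holomorphic_on ball 0 1" "G holomorphic_on ball 0 1"
    "summable (\<lambda>n. (norm (taylor_coeff F n))\<^sup>2)" "summable (\<lambda>n. (norm (taylor_coeff G n))\<^sup>2)"
    using assms(4) bc_hardy2_components[OF comp] by (auto simp: bc_components_def)
  define F' G' where FG'_def: "F' = F \<circ> disc_automorphism l1 w1" "G' = G \<circ> disc_automorphism l2 w2"
  note F' = disc_automorphism_composition[OF l(1) w(1) FG(1,3), folded FG'_def]
  note G' = disc_automorphism_composition[OF l(2) w(2) FG(2,4), folded FG'_def]
  \<comment> \<open>This permits evaluating the component representation of \<open>f\<close> at
    \<open>\<Psi> Z\<close>.\<close>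
  have "\<Psi> Z \<in> bc_disc" if "Z \<in> bc_disc" for Z
    using that norm_disc_automorphism_less[OF l(1) w(1)] norm_disc_automorphism_less[OF l(2) w(2)]
    by (simp add: bc_disc_iff[of Z] bc_disc_iff[of "\<Psi> Z"] \<Psi>[OF that])
  then have comp': "bc_components (bc_comp_op \<Psi> f) F' G'"
    using comp F'(1) G'(1) by (simp add: bc_components_def bc_comp_op_def FG'_def \<Psi>)
  define NF NG NF' NG' where N_def: "NF = (\<Sum>n. (norm (taylor_coeff F n))\<^sup>2)"
    "NG = (\<Sum>n. (norm (taylor_coeff G n))\<^sup>2)" "NF' = (\<Sum>n. (norm (taylor_coeff F' n))\<^sup>2)"
    "NG' = (\<Sum>n. (norm (taylor_coeff G' n))\<^sup>2)"
  have norms: "bc_hardy2_norm f = bc_idem (of_real (sqrt NF)) (of_real (sqrt NG))"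
    "bc_hardy2_norm (bc_comp_op \<Psi> f) = bc_idem (of_real (sqrt NF')) (of_real (sqrt NG'))"
    using bc_hardy2_norm_components[OF comp FG(3,4)] bc_hardy2_norm_components[OF comp' F'(2) G'(2)]
    by (simp_all add: N_def)
  have "bc_comp_op \<Psi> f \<in> bc_hardy2"
    using bc_hardy2_components[OF comp'] F'(2) G'(2) by simp
  \<comment> \<open>The classical bounds concern squared norms; monotonicity and multiplicativity of
    \<open>sqrt\<close> give the bounds for the norms.\<close>
  moreover have "sqrt ((1 - norm w1) / (1 + norm w1)) * sqrt NF \<le> sqrt NF'"
    "sqrt ((1 - norm w2) / (1 + norm w2)) * sqrt NG \<le> sqrt NG'"
    "sqrt NF' \<le> sqrt ((1 + norm w1) / (1 - norm w1)) * sqrt NF"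
    "sqrt NG' \<le> sqrt ((1 + norm w2) / (1 - norm w2)) * sqrt NG"
    using F'(3,4) G'(3,4) unfolding N_def real_sqrt_mult[symmetric] by (simp_all only: real_sqrt_le_iff)
  ultimately show ?thesis
    unfolding norms hyp_sqrt_mod_quotient \<Psi>0 bc_idem_mult_of_real hyp_le_idem_iff by blast
qed

end
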